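(* Let $H$ be a connected $r$-regular $u$-uniform hypergraph on $v$ vertices with adjacency matrix $A$. Let $\tau_0,\tau_1,\ldots,\tau_d$ be the distinct eigenvalues of $H$, where $\tau_0=r(u-1)=k$. If there exists a real polynomial $f(x)=\sum_{i\ge 0} f_i F_i^{(r,u)}(x)$ such that $f(k)>0$, $f(\tau_j)\le 0$ for each $j\in\{1,\ldots,d\}$, $f_0>0$, and $f_i\ge 0$ for each $i\in\{1,\ldots,\deg f\}$, then $$v\le \frac{f(k)}{f_0}.$$ Moreover, equality holds if and only if $f(\tau_j)=0$ for each $j\in\{1,\ldots,d\}$ and $f_i\cdot \mathrm{tr}(F_i^{(r,u)}(A))=0$ for each $i\in\{1,\ldots,\deg f\}$.
   Context: A hypergraph $H=(V,E)$ consists of a finite vertex set $V$ and a set $E$ of subsets of $V$ (edges), each of size at least 2 (no repeated edges). It is $u$-uniform ($u\ge 2$) if every edge has exactly $u$ vertices and $r$-regular ($r\ge 1$) if every vertex is in exactly $r$ edges. A walk of length $p$ from $x_0$ to $x_p$ is a sequence $(x_0,e_1,x_1,\ldots,e_p,x_p)$ of vertices $x_i$ and edges $e_i$ with $x_{i-1},x_i\in e_i$ and $x_{i-1}\ne x_i$ for $1\le i\le p$; $H$ is connected if any two vertices are joined by a walk. The adjacency matrix $A$ is indexed by $V$ with $A_{xy}=|\{e\in E:\{x,y\}\subset e\}|$ for $x\ne y$ and $A_{xx}=0$; the eigenvalues of $H$ are those of $A$. The polynomials $F_i^{(r,u)}(x)$ are defined by $F_0^{(r,u)}(x)=1$, $F_1^{(r,u)}(x)=x$,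 $F_2^{(r,u)}(x)=x^2-(u-2)x-r(u-1)$, and $F_{i+1}^{(r,u)}(x)=(x-u+2)F_i^{(r,u)}(x)-(r-1)(u-1)F_{i-1}^{(r,u)}(x)$ for $i\ge 2$. *)

theory Defs
  imports
    "HOL-Analysis.Determinants"
    "HOL-Computational_Algebra.Polynomial"
begin

text \<open>
  The vertex set of a hypergraph is the universe of a finite type \<open>'v\<close>, so a hypergraph is
  given by its edge set alone, and its adjacency matrix has type \<open>real^'v^'v\<close>.
\<close>

definition hypergraph :: "'v::finite set set \<Rightarrow> bool" where
  "hypergraph E \<longleftrightarrow> (\<forall>e\<in>E. card e \<ge> 2)"

definition uniform :: "nat \<Rightarrow> 'v::finite set set \<Rightarrow> bool" where
  "uniform u E \<longleftrightarrow> (\<forall>e\<in>E. card e = u)"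

definition regular :: "nat \<Rightarrow> 'v::finite set set \<Rightarrow> bool" where
  "regular r E \<longleftrightarrow> (\<forall>x. card {e\<in>E. x \<in> e} = r)"

text \<open>
  The walk \<open>(x\<^sub>0, e\<^sub>1, x\<^sub>1, \<dots>, e\<^sub>p, x\<^sub>p)\<close> is represented by the functions \<open>x\<close> and \<open>e\<close>,
  of which only the values \<open>x 0, \<dots>, x p\<close> and \<open>e 1, \<dots>, e p\<close> matter.
\<close>

definition walk :: "'v::finite set set \<Rightarrow> nat \<Rightarrow> (nat \<Rightarrow> 'v) \<Rightarrow> (nat \<Rightarrow> 'v set) \<Rightarrow> bool" where
  "walk E p x e \<longleftrightarrow>
     (\<forall>i\<in>{1..p}. e i \<in> E \<and> x (i - 1) \<in> e i \<and> x i \<in> e i \<and> x (i - 1) \<noteq> x i)"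

definition connected_hypergraph :: "'v::finite set set \<Rightarrow> bool" where
  "connected_hypergraph E \<longleftrightarrow> (\<forall>a b. \<exists>p x e. walk E p x e \<and> x 0 = a \<and> x p = b)"

definition adjacency_matrix :: "'v::finite set set \<Rightarrow> real^'v^'v" where
  "adjacency_matrix E = (\<chi> x y. if x = y then 0 else real (card {e\<in>E. {x, y} \<subseteq> e}))"

text \<open>
  Only real eigenvalues are considered. Nothing is lost for an adjacency matrix: it is real and
  symmetric, so all its complex eigenvalues are real.
\<close>

definition eigenvalues :: "real^'n^'n \<Rightarrow> real set" where
  "eigenvalues A = {t. \<exists>w. w \<noteq> 0 \<and> A *v w = t *\<^sub>R w}"

text \<open>
  On \<open>real^'n^'n\<close> the operation \<open>*\<close> is the componentwise product, so powers and polynomial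
  evaluation have to be set up with the matrix product \<open>**\<close>.
\<close>

primrec matrix_power :: "real^'n^'n \<Rightarrow> nat \<Rightarrow> real^'n^'n" where
  "matrix_power A 0 = mat 1"
| "matrix_power A (Suc i) = A ** matrix_power A i"

definition poly_matrix :: "real poly \<Rightarrow> real^'n^'n \<Rightarrow> real^'n^'n" where
  "poly_matrix p A = (\<Sum>i\<le>degree p. coeff p i *\<^sub>R matrix_power A i)"

fun F :: "nat \<Rightarrow> nat \<Rightarrow> nat \<Rightarrow> real poly" where
  "F r u 0 = 1"
| "F r u (Suc 0) = [:0, 1:]"
| "F r u (Suc (Suc 0)) = [:- (real r * (real u - 1)), - (real u - 2), 1:]"
| "F r u (Suc (Suc (Suc i))) =
     [:- real u + 2, 1:] * F r u (Suc (Suc i))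
     - smult ((real r - 1) * (real u - 1)) (F r u (Suc i))"

end

theory Submission
  imports Defs "HOL-Analysis.Weierstrass_Theorems"
begin

text \<open>
  For \<open>i \<ge> 1\<close> the entries of \<open>F\<^sub>i(A)\<close> count walks of length \<open>i\<close> whose consecutive edges differ, so
  \<open>tr F\<^sub>i(A) \<ge> 0\<close>. Computing \<open>tr f(A)\<close> once from the expansion of \<open>f\<close> and once in an orthonormal
  basis of eigenvectors gives
  \<open>c\<^sub>0 v + \<Sum>\<^bsub>i\<ge>1\<^esub> c\<^sub>i tr F\<^sub>i(A) = f(k) + \<Sum>\<^bsub>j\<ge>1\<^esub> m\<^sub>j f(\<tau>\<^sub>j)\<close>, where \<open>m\<^sub>j \<ge> 1\<close> is the multiplicity of
  \<open>\<tau>\<^sub>j\<close> and \<open>k\<close> is simple because the hypergraph is connected. The sum on the left is nonnegative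
  and the sum on the right is nonpositive, and equality means that both vanish.
\<close>

section \<open>Symmetric matrices\<close>

lemma quadratic_nonneg_imp_linear_zero:
  fixes a b :: real
  assumes "\<And>t. 0 \<le> 2 * t * a + t\<^sup>2 * b"
  shows "a = 0"
proof -
  have "b \<ge> 0"
    using assms[of 1] assms[of "-1"] by simp
  \<comment> \<open>The minimizer for \<open>b > 0\<close> would be \<open>- a / b\<close>; the
    denominator \<open>b + 1\<close> also covers \<open>b = 0\<close>.\<close>
  have "0 \<le> 2 * (- a / (b + 1)) * a + (- a / (b + 1))\<^sup>2 * b"
    by (rule assms)
  also have "\<dots> = - (a\<^sup>2 * (b + 2) / (b + 1)\<^sup>2)"
    using \<open>b \<ge> 0\<close> by (simp add: power2_eq_square divide_simps) (simp add: algebra_simps)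
  finally have "a\<^sup>2 * (b + 2) / (b + 1)\<^sup>2 \<le> 0"
    by simp
  then have "a\<^sup>2 * (b + 2) \<le> 0"
    using \<open>b \<ge> 0\<close> by (simp add: divide_le_0_iff)
  then show ?thesis
    using \<open>b \<ge> 0\<close> by (simp add: mult_le_0_iff)
qed

lemma symmetric_matrix_inner:
  fixes A :: "real^'n^'n"
  assumes "transpose A = A"
  shows "x \<bullet> (A *v y) = (A *v x) \<bullet> y"
  by (metis assms dot_lmul_matrix transpose_matrix_vector)

text \<open>
  A maximizer \<open>v\<close> of the Rayleigh quotient on \<open>S\<close> is an eigenvector: the form \<open>l |x|\<^sup>2 - x \<bullet> Ax\<close>
  is nonnegative on \<open>S\<close> and vanishes at \<open>v\<close>, hence has zero derivative there.
\<close>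

lemma symmetric_matrix_eigenvector_in_subspace:
  fixes A :: "real^'n^'n"
  assumes A: "transpose A = A" and S: "subspace S" "\<And>x. x \<in> S \<Longrightarrow> A *v x \<in> S"
    and "x0 \<in> S" "x0 \<noteq> 0"
  obtains v where "v \<in> S" "norm v = 1" "A *v v = (v \<bullet> (A *v v)) *\<^sub>R v"
proof -
  have "compact (sphere 0 1 \<inter> S)"
    using S(1) by (intro compact_Int_closed closed_subspace) auto
  moreover have "sphere 0 1 \<inter> S \<noteq> {}"
  proof -
    have "x0 /\<^sub>R norm x0 \<in> sphere 0 1 \<inter> S"
      using assms by (auto simp: subspace_scale)
    then show ?thesis by blast
  qed
  moreover have "continuous_on (sphere 0 1 \<inter> S) (\<lambda>x. x \<bullet> (A *v x))"
    by (intro continuous_intros linear_continuous_on) (simp add: linear_linear)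
  ultimately have "\<exists>v\<in>sphere 0 1 \<inter> S. \<forall>x\<in>sphere 0 1 \<inter> S. x \<bullet> (A *v x) \<le> v \<bullet> (A *v v)"
    by (rule continuous_attains_sup)
  then obtain v where v: "v \<in> S" "norm v = 1"
    and max: "\<And>x. x \<in> S \<Longrightarrow> norm x = 1 \<Longrightarrow> x \<bullet> (A *v x) \<le> v \<bullet> (A *v v)"
    by (metis IntE IntI mem_sphere_0)
  define l where "l = v \<bullet> (A *v v)"
  have nonneg: "0 \<le> l * (x \<bullet> x) - x \<bullet> (A *v x)" if "x \<in> S" for x
  proof (cases "x = 0")
    case False
    have "(x /\<^sub>R norm x) \<bullet> (A *v (x /\<^sub>R norm x)) \<le> l"
      unfolding l_def using that False S(1) by (intro max) (auto simp: subspace_scale)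
    then have "(x \<bullet> (A *v x)) / (norm x)\<^sup>2 \<le> l"
      by (simp add: matrix_vector_mult_scaleR power2_eq_square divide_inverse mult_ac)
    then show ?thesis
      using False by (simp add: divide_le_eq dot_square_norm)
  qed simp
  \<comment> \<open>The residual \<open>w\<close> is itself an admissible direction in
    \<open>S\<close>. Along \<open>v + t *\<^sub>R w\<close> the form has constant term 0 and linear
    coefficient \<open>2 * (w \<bullet> w)\<close>, which must vanish.\<close>
  define w where "w = l *\<^sub>R v - A *v v"
  have "w \<in> S"
    unfolding w_def using S v by (simp add: subspace_diff subspace_scale)
  have "0 \<le> 2 * t * (w \<bullet> w) + t\<^sup>2 * (l * (w \<bullet> w) - w \<bullet> (A *v w))" for t
  proof -
    have "v + t *\<^sub>R w \<in> S"
      using S(1) v \<open>w \<in> S\<close> by (simp add: subspace_add subspace_scale)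
    from nonneg[OF this] have "0 \<le> (l * (v \<bullet> v) - v \<bullet> (A *v v))
        + 2 * t * (l * (v \<bullet> w) - (A *v v) \<bullet> w) + t\<^sup>2 * (l * (w \<bullet> w) - w \<bullet> (A *v w))"
      by (simp add: algebra_simps matrix_vector_right_distrib matrix_vector_mult_scaleR
          inner_commute[of w v] symmetric_matrix_inner[OF A, of v w]
          inner_commute[of w "A *v v"] power2_eq_square)
    moreover have "l * (v \<bullet> v) - v \<bullet> (A *v v) = 0"
      using v by (simp add: l_def norm_eq_1)
    moreover have "l * (v \<bullet> w) - (A *v v) \<bullet> w = w \<bullet> w"
      by (simp add: w_def inner_diff_left)
    ultimately show ?thesis
      by simp
  qed
  then have "w \<bullet> w = 0"
    by (rule quadratic_nonneg_imp_linear_zero)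
  then have "A *v v = l *\<^sub>R v"
    by (simp add: w_def)
  with v show thesis
    unfolding l_def by (rule that)
qed

text \<open>Eigenvectors are added one at a time: by symmetry the orthogonal complement of those
  already found is invariant under \<open>A\<close>, so it contains another one as long as it is
  nonzero.\<close>

lemma symmetric_matrix_orthonormal_eigenbasis:
  fixes A :: "real^'n^'n"
  assumes A: "transpose A = A"
  obtains B where "finite B" "pairwise orthogonal B" "\<And>b. b \<in> B \<Longrightarrow> norm b = 1" "span B = UNIV"
    "\<And>b. b \<in> B \<Longrightarrow> A *v b = (b \<bullet> (A *v b)) *\<^sub>R b"
proof -
  let ?P = "\<lambda>B. finite B \<and> pairwise orthogonal B \<and>
    (\<forall>b\<in>B. norm b = 1 \<and> A *v b = (b \<bullet> (A *v b)) *\<^sub>R b)"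
  have "\<exists>B. ?P B \<and> card B = m" if "m \<le> CARD('n)" for m
    using that
  proof (induction m)
    case 0
    show ?case by (intro exI[of _ "{}"]) auto
  next
    case (Suc m)
    then obtain B where B: "?P B" "card B = m" by auto
    define S where "S = {x. \<forall>b\<in>B. orthogonal b x}"
    have "dim B < DIM(real^'n)"
      using Suc.prems B dim_le_card[of B B] by (auto simp: span_superset)
    then obtain x0 where "x0 \<noteq> 0" "\<And>y. y \<in> span B \<Longrightarrow> orthogonal x0 y"
      using orthogonal_to_subspace_exists by blast
    then have x0: "x0 \<in> S" "x0 \<noteq> 0"
      by (auto simp: S_def orthogonal_commute span_base)
    have "A *v x \<in> S" if "x \<in> S" for x
      unfolding S_def
    proof safe
      fix b assume "b \<in> B"
      have "b \<bullet> (A *v x) = (A *v b) \<bullet> x"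
        by (rule symmetric_matrix_inner[OF A])
      also have "\<dots> = ((b \<bullet> (A *v b)) *\<^sub>R b) \<bullet> x"
        using B \<open>b \<in> B\<close> by metis
      also have "\<dots> = 0"
        using that \<open>b \<in> B\<close> by (simp add: S_def orthogonal_def)
      finally show "orthogonal b (A *v x)"
        by (simp add: orthogonal_def)
    qed
    then obtain v where v: "v \<in> S" "norm v = 1" "A *v v = (v \<bullet> (A *v v)) *\<^sub>R v"
      using symmetric_matrix_eigenvector_in_subspace[OF A _ _ x0]
      by (metis S_def subspace_orthogonal_to_vectors)
    have "v \<notin> B"
    proof
      assume "v \<in> B"
      then have "orthogonal v v" using v(1) by (simp add: S_def)
      then show False using v(2) by (simp add: orthogonal_self)
    qed
    then have "?P (insert v B)" "card (insert v B) = Suc m"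
      using B v by (auto simp: pairwise_insert S_def orthogonal_commute)
    then show ?case by blast
  qed
  then obtain B where B: "?P B" "card B = CARD('n)" by blast
  have "0 \<notin> B"
    using B by (metis norm_zero zero_neq_one)
  then have "independent B"
    using B by (intro pairwise_orthogonal_independent) auto
  then have "span B = UNIV"
    using B by (metis DIM_cart DIM_real dim_eq_card_independent dim_eq_full mult.right_neutral)
  with B show thesis
    by (intro that[of B]) auto
qed

text \<open>Expanding the standard basis vectors in \<open>B\<close> gives the completeness
  relation, that is, the matrices \<open>b b^T\<close> sum to the identity.\<close>

lemma trace_eq_sum_orthonormal_basis:
  fixes M :: "real^'n^'n"
  assumes "finite B" "pairwise orthogonal B" "\<And>b. b \<in> B \<Longrightarrow> norm b = 1" "span B = UNIV"
  shows "trace M = (\<Sum>b\<in>B. b \<bullet> (M *v b))"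
proof -
  have "(\<Sum>b\<in>B. b$i * b$j) = (if i = j then 1 else 0)" for i j
  proof -
    have "(\<Sum>b\<in>B. (axis j 1 \<bullet> b) *\<^sub>R b) = axis j (1::real)"
      using assms by (intro orthonormal_basis_expand) auto
    then have "(\<Sum>b\<in>B. (axis j 1 \<bullet> b) *\<^sub>R b) $ i = axis j (1::real) $ i"
      by simp
    then show ?thesis
      by (auto simp: inner_axis') (auto simp: axis_def mult.commute)
  qed
  then have "trace M = (\<Sum>i\<in>UNIV. \<Sum>j\<in>UNIV. M$i$j * (\<Sum>b\<in>B. b$i * b$j))"
    by (simp add: trace_def if_distrib[of "\<lambda>a. _ * a"] cong: if_cong)
  also have "\<dots> = (\<Sum>i\<in>UNIV. \<Sum>b\<in>B. \<Sum>j\<in>UNIV. b$i * (M$i$j * b$j))"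
    by (intro sum.cong refl) (subst sum.swap, simp add: sum_distrib_left mult_ac)
  also have "\<dots> = (\<Sum>b\<in>B. \<Sum>i\<in>UNIV. \<Sum>j\<in>UNIV. b$i * (M$i$j * b$j))"
    by (rule sum.swap)
  also have "\<dots> = (\<Sum>b\<in>B. b \<bullet> (M *v b))"
    by (simp add: inner_vec_def matrix_vector_mult_def sum_distrib_left)
  finally show ?thesis .
qed

section \<open>Polynomials in a matrix\<close>

lemma matrix_mul_sum_right: "A ** (\<Sum>i\<in>I. M i) = (\<Sum>i\<in>I. A ** M i)"
  by (induction I rule: infinite_finite_induct) (simp_all add: matrix_add_ldistrib)

lemma matrix_add_rdistrib: "(A + B) ** C = A ** C + B ** C"
  by (vector matrix_matrix_mult_def sum.distrib[symmetric] field_simps)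

lemma matrix_mul_sum_left: "(\<Sum>i\<in>I. M i) ** A = (\<Sum>i\<in>I. M i ** A)"
  by (induction I rule: infinite_finite_induct) (simp_all add: matrix_add_rdistrib)

lemma matrix_diff_ldistrib: "A ** (B - C) = A ** B - A ** (C :: real^'p^'n)"
  using matrix_add_ldistrib[of A "B - C" C] by simp

text \<open>A common summation bound allows polynomials of different degrees to be combined
  termwise.\<close>

lemma poly_matrix_altdef:
  assumes "degree p \<le> n"
  shows "poly_matrix p A = (\<Sum>i\<le>n. coeff p i *\<^sub>R matrix_power A i)"
  unfolding poly_matrix_def using assms
  by (intro sum.mono_neutral_left) (auto simp: coeff_eq_0)

lemma poly_matrix_0 [simp]: "poly_matrix 0 A = 0"
  by (simp add: poly_matrix_def)

lemma poly_matrix_1 [simp]: "poly_matrix 1 A = mat 1"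
  by (simp add: poly_matrix_def)

lemma poly_matrix_add: "poly_matrix (p + q) A = poly_matrix p A + poly_matrix q A"
proof -
  let ?n = "max (degree p) (degree q)"
  have "degree (p + q) \<le> ?n"
    by (rule degree_add_le_max)
  then show ?thesis
    by (simp add: poly_matrix_altdef[of _ ?n] scaleR_add_left sum.distrib)
qed

lemma poly_matrix_smult: "poly_matrix (smult a p) A = a *\<^sub>R poly_matrix p A"
  by (simp add: poly_matrix_altdef[of _ "degree p"] scaleR_sum_right)

lemma poly_matrix_diff: "poly_matrix (p - q) A = poly_matrix p A - poly_matrix q A"
  using poly_matrix_add[of p "- q" A] poly_matrix_smult[of "- 1" q A] by simp

lemma poly_matrix_sum: "poly_matrix (\<Sum>i\<in>I. p i) A = (\<Sum>i\<in>I. poly_matrix (p i) A)"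
  by (induction I rule: infinite_finite_induct) (simp_all add: poly_matrix_add)

lemma poly_matrix_pCons: "poly_matrix (pCons a p) A = a *\<^sub>R mat 1 + A ** poly_matrix p A"
proof -
  have "poly_matrix (pCons a p) A
      = (\<Sum>i\<le>Suc (degree p). coeff (pCons a p) i *\<^sub>R matrix_power A i)"
    by (rule poly_matrix_altdef) (rule degree_pCons_le)
  then show ?thesis
    by (simp add: sum.atMost_Suc_shift matrix_mul_sum_right matrix_scalar_ac
        scalar_matrix_assoc poly_matrix_def del: sum.atMost_Suc)
qed

lemma poly_matrix_eigenvector:
  assumes "A *v w = t *\<^sub>R w"
  shows "poly_matrix p A *v w = poly p t *\<^sub>R w"
  by (induction p)
    (simp_all add: poly_matrix_pCons matrix_vector_mult_add_rdistrib assms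
      scaleR_matrix_vector_assoc[symmetric] matrix_vector_mul_assoc[symmetric]
      matrix_vector_mult_scaleR scaleR_add_left mult.commute)

lemma trace_poly_matrix_eigenbasis:
  fixes A :: "real^'n^'n"
  assumes "finite B" "pairwise orthogonal B" "\<And>b. b \<in> B \<Longrightarrow> norm b = 1" "span B = UNIV"
    and ev: "\<And>b. b \<in> B \<Longrightarrow> A *v b = l b *\<^sub>R b"
  shows "trace (poly_matrix p A) = (\<Sum>b\<in>B. poly p (l b))"
proof -
  have "trace (poly_matrix p A) = (\<Sum>b\<in>B. b \<bullet> (poly_matrix p A *v b))"
    using assms by (intro trace_eq_sum_orthonormal_basis) auto
  also have "\<dots> = (\<Sum>b\<in>B. poly p (l b))"
    using assms by (intro sum.cong) (auto simp: poly_matrix_eigenvector[OF ev] norm_eq_1[symmetric]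
        dot_square_norm)
  finally show ?thesis .
qed

text \<open>A nonzero \<open>w\<close> cannot be orthogonal to all of \<open>B\<close>, and
  eigenvectors of a symmetric matrix that are not orthogonal share their eigenvalue.\<close>

lemma eigenvalue_in_eigenbasis:
  fixes A :: "real^'n^'n"
  assumes A: "transpose A = A" and "span B = UNIV"
    and ev: "\<And>b. b \<in> B \<Longrightarrow> A *v b = l b *\<^sub>R b"
    and w: "w \<noteq> 0" "A *v w = t *\<^sub>R w"
  obtains b where "b \<in> B" "l b = t"
proof -
  have "\<exists>b\<in>B. b \<bullet> w \<noteq> 0"
  proof (rule ccontr)
    assume "\<not> (\<exists>b\<in>B. b \<bullet> w \<noteq> 0)"
    then have "orthogonal w w"
      using assms(2) by (intro orthogonal_to_span[of w B]) (auto simp: orthogonal_def inner_commute)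
    then show False
      using w by (simp add: orthogonal_self)
  qed
  then obtain b where b: "b \<in> B" "b \<bullet> w \<noteq> 0" by blast
  have "t * (b \<bullet> w) = l b * (b \<bullet> w)"
    using symmetric_matrix_inner[OF A, of b w] w ev[OF b(1)] by simp
  then show thesis
    using b by (intro that[of b]) auto
qed

section \<open>Walks without repeated consecutive edges\<close>

text \<open>The adjacency matrix of the complete graph on \<open>e\<close>, all other vertices being
  isolated.\<close>

definition edge_matrix :: "'v::finite set \<Rightarrow> real^'v^'v" where
  "edge_matrix e = (\<chi> x y. if x \<noteq> y \<and> x \<in> e \<and> y \<in> e then 1 else 0)"

definition diag_indicator :: "'v::finite set \<Rightarrow> real^'v^'v" where
  "diag_indicator e = (\<chi> x y. if x = y \<and> x \<in> e then 1 else 0)"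

text \<open>
  The entry at \<open>(x, y)\<close> of \<open>nonbacktracking E n e\<close> counts the walks of length \<open>n + 1\<close> from \<open>x\<close> to
  \<open>y\<close> that start with the edge \<open>e\<close> and in which consecutive edges differ.
\<close>

primrec nonbacktracking :: "'v::finite set set \<Rightarrow> nat \<Rightarrow> 'v set \<Rightarrow> real^'v^'v" where
  "nonbacktracking E 0 e = edge_matrix e"
| "nonbacktracking E (Suc n) e = edge_matrix e ** (\<Sum>e'\<in>E - {e}. nonbacktracking E n e')"

lemma nonbacktracking_nonneg: "0 \<le> nonbacktracking E n e $ x $ y"
  by (induction n arbitrary: e x y)
    (auto simp: edge_matrix_def matrix_matrix_mult_def intro!: sum_nonneg)

text \<open>Rows outside \<open>e\<close> vanish, so restricting the starting vertex to
  \<open>e\<close> changes nothing.\<close>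

lemma diag_mult_edge_matrix: "diag_indicator e ** edge_matrix e = edge_matrix e"
proof -
  have "(\<Sum>z\<in>UNIV. diag_indicator e $ x $ z * edge_matrix e $ z $ y)
      = (\<Sum>z\<in>UNIV. if z = x then edge_matrix e $ x $ y else 0)" for x y
    by (intro sum.cong) (auto simp: diag_indicator_def edge_matrix_def)
  then show ?thesis
    by (simp add: vec_eq_iff matrix_matrix_mult_def)
qed

text \<open>Two steps inside \<open>e\<close> from \<open>x\<close> to \<open>y\<close> have their
  midpoint in \<open>e - {x, y}\<close>, which leaves \<open>u - 2\<close> choices if
  \<open>x \<noteq> y\<close> and \<open>u - 1\<close> if \<open>x = y\<close>.\<close>

lemma edge_matrix_square:
  assumes "card e = u" "u \<ge> 2"
  shows "edge_matrix e ** edge_matrix e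
    = (real u - 2) *\<^sub>R edge_matrix e + (real u - 1) *\<^sub>R diag_indicator e"
proof -
  have "(\<Sum>z\<in>UNIV. edge_matrix e $ x $ z * edge_matrix e $ z $ y)
     = (real u - 2) * edge_matrix e $ x $ y + (real u - 1) * diag_indicator e $ x $ y" for x y
  proof -
    have "(\<Sum>z\<in>UNIV. edge_matrix e $ x $ z * edge_matrix e $ z $ y)
       = (\<Sum>z\<in>UNIV. if x \<in> e \<and> y \<in> e \<and> z \<in> e - {x, y} then 1 else 0)"
      by (intro sum.cong) (auto simp: edge_matrix_def)
    also have "\<dots> = (if x \<in> e \<and> y \<in> e then real (card (e - {x, y})) else 0)"
      by (cases "x \<in> e"; cases "y \<in> e") (simp_all add: sum.If_cases del: Diff_iff)
    also have "\<dots> = (real u - 2) * edge_matrix e $ x $ y + (real u - 1) * diag_indicator e $ x $ y"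
      using assms by (auto simp: edge_matrix_def diag_indicator_def card_Diff_subset of_nat_diff)
    finally show ?thesis .
  qed
  then show ?thesis
    by (simp add: vec_eq_iff matrix_matrix_mult_def)
qed

lemma sum_diag_indicator:
  assumes "regular r E"
  shows "(\<Sum>e\<in>E. diag_indicator e) = real r *\<^sub>R mat 1"
proof -
  have "(\<Sum>e\<in>E. if x \<in> e then 1 else (0::real)) = real r" for x
    using assms by (simp add: regular_def sum.If_cases Int_def)
  then show ?thesis
    by (auto simp: vec_eq_iff diag_indicator_def mat_def)
qed

lemma sum_edge_matrix: "(\<Sum>e\<in>E. edge_matrix e) = adjacency_matrix E"
  by (auto simp: vec_eq_iff edge_matrix_def adjacency_matrix_def sum.If_cases Int_def)

text \<open>
  Writing \<open>A = \<Sum>\<^sub>e B\<^sub>e\<close>, the recurrence of \<open>F\<close> comes from correcting \<open>A N\<close> by the walks that repeat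
  their first edge; these are counted by means of \<open>B\<^sub>e\<^sup>2 = (u - 2) B\<^sub>e + (u - 1) D\<^sub>e\<close>.
\<close>

lemma poly_matrix_F_eq_sum_nonbacktracking:
  assumes "regular r E" "uniform u E" "u \<ge> 2"
  shows "poly_matrix (F r u (Suc n)) (adjacency_matrix E) = (\<Sum>e\<in>E. nonbacktracking E n e)"
proof -
  let ?A = "adjacency_matrix E" and ?W = "nonbacktracking E"
  define N where "N n = (\<Sum>e\<in>E. ?W n e)" for n
  have fin: "finite E" by simp
  have W_Suc: "?W (Suc n) e = edge_matrix e ** (N n - ?W n e)" if "e \<in> E" for n e
    using that fin by (simp add: N_def sum_diff1)
  have square: "edge_matrix e ** edge_matrix e
      = (real u - 2) *\<^sub>R edge_matrix e + (real u - 1) *\<^sub>R diag_indicator e" if "e \<in> E" for e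
    using assms that by (intro edge_matrix_square) (auto simp: uniform_def)
  have diag_W: "diag_indicator e ** ?W n e = ?W n e" for n e
    by (cases n) (simp_all add: matrix_mul_assoc diag_mult_edge_matrix)
  have N_Suc: "N (Suc n) = ?A ** N n - (\<Sum>e\<in>E. edge_matrix e ** ?W n e)" for n
  proof -
    have "N (Suc n) = (\<Sum>e\<in>E. edge_matrix e ** N n - edge_matrix e ** ?W n e)"
      unfolding N_def[of "Suc n"] by (intro sum.cong) (simp_all only: W_Suc matrix_diff_ldistrib)
    then show ?thesis
      by (simp add: sum_subtractf matrix_mul_sum_left[symmetric] sum_edge_matrix)
  qed
  \<comment> \<open>The matrices \<open>diag_indicator e\<close> sum to \<open>r\<close> times the
    identity, which produces the exceptional constant \<open>r(u - 1)\<close> of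
    \<open>F r u 2\<close>.\<close>
  have back_0: "(\<Sum>e\<in>E. edge_matrix e ** ?W 0 e)
      = (real u - 2) *\<^sub>R ?A + (real r * (real u - 1)) *\<^sub>R mat 1"
    by (simp add: square sum.distrib scaleR_sum_right[symmetric] sum_edge_matrix
        sum_diag_indicator[OF assms(1)] mult.commute)
  \<comment> \<open>Here \<open>e\<close> must be followed by a different edge. Subtracting
    \<open>?W n e\<close> costs one copy of \<open>N n\<close> in total and turns \<open>r\<close>
    into \<open>r - 1\<close>.\<close>
  have back_Suc: "(\<Sum>e\<in>E. edge_matrix e ** ?W (Suc n) e)
      = (real u - 2) *\<^sub>R N (Suc n) + ((real r - 1) * (real u - 1)) *\<^sub>R N n" for n
  proof -
    have "edge_matrix e ** ?W (Suc n) e = (real u - 2) *\<^sub>R ?W (Suc n) e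
        + (real u - 1) *\<^sub>R (diag_indicator e ** N n - ?W n e)" if "e \<in> E" for e
      unfolding W_Suc[OF that] matrix_mul_assoc square[OF that]
      by (simp add: matrix_add_rdistrib scalar_matrix_assoc[symmetric] matrix_diff_ldistrib diag_W)
        (simp add: algebra_simps)
    then have "(\<Sum>e\<in>E. edge_matrix e ** ?W (Suc n) e) = (\<Sum>e\<in>E. (real u - 2) *\<^sub>R ?W (Suc n) e
        + (real u - 1) *\<^sub>R (diag_indicator e ** N n - ?W n e))"
      by (rule sum.cong[OF refl])
    also have "\<dots> = (real u - 2) *\<^sub>R N (Suc n)
        + (real u - 1) *\<^sub>R ((real r *\<^sub>R mat 1) ** N n - N n)"
      unfolding sum.distrib scaleR_sum_right[symmetric] sum_subtractf
        matrix_mul_sum_left[symmetric] sum_diag_indicator[OF assms(1)] N_def[symmetric] ..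
    also have "\<dots> = (real u - 2) *\<^sub>R N (Suc n) + ((real r - 1) * (real u - 1)) *\<^sub>R N n"
      by (simp add: scalar_matrix_assoc[symmetric] algebra_simps)
    finally show ?thesis .
  qed
  have "poly_matrix (F r u (Suc n)) ?A = N n"
  \<comment> \<open>The index is shifted, \<open>N n\<close> belonging to
    \<open>F r u (Suc n)\<close>; the base cases are therefore \<open>F\<close> at 1 and 2, and the
    uniform recurrence starts at 3.\<close>
  proof (induction n rule: induct_nat_012)
    case 0
    then show ?case
      by (simp add: poly_matrix_pCons N_def sum_edge_matrix)
  next
    case 1
    have "poly_matrix (F r u (Suc (Suc 0))) ?A
        = ?A ** ?A - (real u - 2) *\<^sub>R ?A - (real r * (real u - 1)) *\<^sub>R mat 1"
      by (simp add: poly_matrix_pCons matrix_add_ldistrib matrix_diff_ldistrib matrix_scalar_ac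
          scaleR_left_diff_distrib)
    also have "\<dots> = N (Suc 0)"
      unfolding N_Suc back_0 by (simp add: N_def sum_edge_matrix)
    finally show ?case .
  next
    case (ge2 n)
    have "F r u (Suc (Suc (Suc n))) = smult (- real u + 2) (F r u (Suc (Suc n)))
        + pCons 0 (F r u (Suc (Suc n))) - smult ((real r - 1) * (real u - 1)) (F r u (Suc n))"
      by simp
    then have "poly_matrix (F r u (Suc (Suc (Suc n)))) ?A = (- real u + 2) *\<^sub>R N (Suc n)
        + ?A ** N (Suc n) - ((real r - 1) * (real u - 1)) *\<^sub>R N n"
      by (simp only: poly_matrix_diff poly_matrix_smult poly_matrix_add poly_matrix_pCons ge2)
        simp
    also have "\<dots> = N (Suc (Suc n))"
      unfolding N_Suc[of "Suc n"] back_Suc by (simp add: algebra_simps)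
    finally show ?case .
  qed
  then show ?thesis
    by (simp add: N_def)
qed

corollary trace_poly_matrix_F_nonneg:
  assumes "regular r E" "uniform u E" "u \<ge> 2" "i \<ge> 1"
  shows "trace (poly_matrix (F r u i) (adjacency_matrix E)) \<ge> 0"
proof -
  obtain n where "i = Suc n"
    using assms(4) by (cases i) auto
  then show ?thesis
    using assms by (auto simp: poly_matrix_F_eq_sum_nonbacktracking trace_def
        intro!: sum_nonneg nonbacktracking_nonneg)
qed

section \<open>The eigenvalue \<open>r(u - 1)\<close>\<close>

lemma transpose_adjacency_matrix: "transpose (adjacency_matrix E) = adjacency_matrix E"
  by (auto simp: adjacency_matrix_def transpose_def vec_eq_iff insert_commute)

text \<open>Double counting: each of the \<open>r\<close> edges through \<open>x\<close> contributes
  its \<open>u - 1\<close> other vertices.\<close>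

lemma adjacency_matrix_row_sum:
  assumes "regular r E" "uniform u E"
  shows "(\<Sum>y\<in>UNIV. adjacency_matrix E $ x $ y) = real r * (real u - 1)"
proof -
  have "(\<Sum>y\<in>UNIV. adjacency_matrix E $ x $ y) = (\<Sum>e\<in>E. \<Sum>y\<in>UNIV. edge_matrix e $ x $ y)"
    by (subst sum.swap) (simp add: sum_edge_matrix[symmetric])
  also have "\<dots> = (\<Sum>e\<in>E. if x \<in> e then real u - 1 else 0)"
  proof (rule sum.cong[OF refl])
    fix e assume "e \<in> E"
    have "(\<Sum>y\<in>UNIV. edge_matrix e $ x $ y)
        = (\<Sum>y\<in>UNIV. if x \<in> e \<and> y \<in> e - {x} then 1 else 0)"
      by (intro sum.cong) (auto simp: edge_matrix_def)
    also have "\<dots> = (if x \<in> e then real (card (e - {x})) else 0)"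
      by (cases "x \<in> e") (simp_all add: sum.If_cases del: Diff_iff)
    also have "\<dots> = (if x \<in> e then real u - 1 else 0)"
      using assms(2) \<open>e \<in> E\<close> card_Suc_Diff1[OF finite, of x e]
      by (auto simp: uniform_def simp flip: of_nat_Suc)
    finally show "(\<Sum>y\<in>UNIV. edge_matrix e $ x $ y) = (if x \<in> e then real u - 1 else 0)" .
  qed
  also have "\<dots> = real r * (real u - 1)"
    using assms by (simp add: regular_def sum.If_cases Int_def)
  finally show ?thesis .
qed

text \<open>
  Maximum principle: the set where \<open>w\<close> is maximal is closed under adjacency.
\<close>

lemma top_eigenvector_constant:
  assumes "regular r E" "uniform u E" "connected_hypergraph E"
    and w: "adjacency_matrix E *v w = (real r * (real u - 1)) *\<^sub>R w"
  shows "w $ a = w $ b"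
proof -
  let ?A = "adjacency_matrix E"
  obtain m where m: "\<And>y. w $ y \<le> w $ m"
  proof -
    have "Max (range (($) w)) \<in> range (($) w)"
      by (intro Max_in) auto
    then obtain m where "Max (range (($) w)) = w $ m" by blast
    then have "w $ y \<le> w $ m" for y
      by (metis Max_ge finite finite_imageI rangeI)
    then show thesis by (rule that)
  qed
  have step: "w $ y = w $ m" if "w $ x = w $ m" "e \<in> E" "x \<in> e" "y \<in> e" "x \<noteq> y" for x y e
  proof -
    \<comment> \<open>The eigenvalue equals the row sum, so the weighted deviations from the maximum
      cancel at \<open>x\<close>; being nonnegative, each of them is zero.\<close>
    have "(\<Sum>z\<in>UNIV. ?A $ x $ z * (w $ m - w $ z)) = 0"
    proof -
      have "(\<Sum>z\<in>UNIV. ?A $ x $ z * w $ z) = (\<Sum>z\<in>UNIV. ?A $ x $ z) * w $ m"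
        using arg_cong[OF w, of "\<lambda>v. v $ x"] that(1)
        by (simp add: matrix_vector_mult_def adjacency_matrix_row_sum[OF assms(1,2)])
      then show ?thesis
        by (simp add: right_diff_distrib sum_subtractf sum_distrib_right)
    qed
    then have "\<forall>z\<in>UNIV. ?A $ x $ z * (w $ m - w $ z) = 0"
      using m by (subst (asm) sum_nonneg_eq_0_iff) (auto simp: adjacency_matrix_def)
    moreover have "?A $ x $ y \<noteq> 0"
      using that by (auto simp: adjacency_matrix_def card_eq_0_iff)
    ultimately show ?thesis by auto
  qed
  have "w $ b = w $ m" for b
  proof -
    obtain p x e where walk: "walk E p x e" "x 0 = m" "x p = b"
      using assms(3) unfolding connected_hypergraph_def
      by (elim allE[of _ m] allE[of _ b] exE conjE)
    have "w $ x i = w $ m" if "i \<le> p" for i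
      using that
    proof (induction i)
      case (Suc i)
      then have "e (Suc i) \<in> E" "x i \<in> e (Suc i)" "x (Suc i) \<in> e (Suc i)" "x i \<noteq> x (Suc i)"
        using walk(1) by (force simp: walk_def)+
      moreover have "w $ x i = w $ m"
        using Suc by simp
      ultimately show ?case
        using step by metis
    qed (simp add: walk)
    from this[of p] show ?thesis
      using walk by simp
  qed
  then show ?thesis by metis
qed

lemma adjacency_matrix_ones:
  assumes "regular r E" "uniform u E"
  shows "adjacency_matrix E *v 1 = (real r * (real u - 1)) *\<^sub>R 1"
  using adjacency_matrix_row_sum[OF assms] by (simp add: vec_eq_iff matrix_vector_mult_def)

section \<open>Comparing the two evaluations of the trace of \<open>f\<close> at the adjacency
  matrix\<close>

theorem theorem4p4:
  fixes E :: "'v::finite set set"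
    and r u d :: nat
    and k :: real
    and \<tau> :: "nat \<Rightarrow> real"
    and f :: "real poly"
    and c :: "nat \<Rightarrow> real"
  assumes "r \<ge> 1" and "u \<ge> 2"
    and "hypergraph E" and "connected_hypergraph E" and "regular r E" and "uniform u E"
    and "k = real r * (real u - 1)"
    and "inj_on \<tau> {0..d}" and "\<tau> ` {0..d} = eigenvalues (adjacency_matrix E)" and "\<tau> 0 = k"
    and "f = (\<Sum>i\<le>degree f. smult (c i) (F r u i))"
    and "poly f k > 0"
    and "\<forall>j\<in>{1..d}. poly f (\<tau> j) \<le> 0"
    and "c 0 > 0"
    and "\<forall>i\<in>{1..degree f}. c i \<ge> 0"
  shows "real CARD('v) \<le> poly f k / c 0 \<and>
    (real CARD('v) = poly f k / c 0 \<longleftrightarrow>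
      (\<forall>j\<in>{1..d}. poly f (\<tau> j) = 0) \<and>
      (\<forall>i\<in>{1..degree f}. c i * trace (poly_matrix (F r u i) (adjacency_matrix E)) = 0))"
proof -
  let ?A = "adjacency_matrix E"
  let ?T = "\<lambda>i. c i * trace (poly_matrix (F r u i) ?A)"
  obtain B where B: "finite B" "pairwise orthogonal B" "\<And>b. b \<in> B \<Longrightarrow> norm b = 1" "span B = UNIV"
    and evB: "\<And>b. b \<in> B \<Longrightarrow> ?A *v b = (b \<bullet> (?A *v b)) *\<^sub>R b"
    using symmetric_matrix_orthonormal_eigenbasis[OF transpose_adjacency_matrix] by metis
  define l where "l b = b \<bullet> (?A *v b)" for b
  have ev: "?A *v b = l b *\<^sub>R b" if "b \<in> B" for b
    using evB[OF that] by (simp add: l_def)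
  have nz: "b \<noteq> 0" if "b \<in> B" for b
    using B(3)[OF that] by auto
  have "?A *v 1 = k *\<^sub>R 1" "(1 :: real^'v) \<noteq> 0"
    using adjacency_matrix_ones[OF assms(5,6)] assms(7) by simp_all
  then obtain b0 where b0: "b0 \<in> B" "l b0 = k"
    using eigenvalue_in_eigenbasis[OF transpose_adjacency_matrix B(4) ev] by metis
  \<comment> \<open>Eigenvectors for \<open>k\<close> are constant, and two orthogonal constant
    vectors cannot both be nonzero.\<close>
  have simple: "b = b0" if "b \<in> B" "l b = k" for b
  proof (rule ccontr)
    assume "b \<noteq> b0"
    then have "b \<bullet> b0 = 0"
      using B(2) that b0 by (auto simp: pairwise_def orthogonal_def)
    obtain a :: 'v where True by blast
    have const: "\<And>x. b $ x = b $ a" "\<And>x. b0 $ x = b0 $ a"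
      using that b0 ev assms(7) top_eigenvector_constant[OF assms(5,6,4)] by metis+
    then have "b \<bullet> b0 = (\<Sum>x\<in>(UNIV :: 'v set). b $ a * b0 $ a)"
      unfolding inner_vec_def by (intro sum.cong refl) (metis inner_real_def)
    then have "b $ a = 0 \<or> b0 $ a = 0"
      using \<open>b \<bullet> b0 = 0\<close> by simp
    then show False
      using const nz that(1) b0(1) by (metis vec_eq_iff zero_index)
  qed
  \<comment> \<open>Since \<open>k\<close> is simple, removing \<open>b0\<close> removes exactly the
    value \<open>\<tau> 0\<close>; the other eigenvalues may repeat over \<open>B - {b0}\<close>,
    which accounts for their multiplicities.\<close>
  have rest: "l ` (B - {b0}) = \<tau> ` {1..d}"
  proof (intro equalityI subsetI)
    fix t assume "t \<in> l ` (B - {b0})"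
    then obtain b where b: "b \<in> B" "b \<noteq> b0" "t = l b" by auto
    then have "l b \<in> eigenvalues ?A" "l b \<noteq> \<tau> 0"
      using ev nz simple assms(10) by (auto simp: eigenvalues_def)
    then obtain j where "j \<le> d" "l b = \<tau> j" "j \<noteq> 0"
      unfolding assms(9)[symmetric] by force
    then show "t \<in> \<tau> ` {1..d}" using b by auto
  next
    fix t assume "t \<in> \<tau> ` {1..d}"
    then obtain j where j: "j \<in> {1..d}" "t = \<tau> j" by auto
    then have "\<tau> j \<in> eigenvalues ?A"
      using assms(9) by auto
    then obtain b where b: "b \<in> B" "l b = \<tau> j"
      using eigenvalue_in_eigenbasis[OF transpose_adjacency_matrix B(4) ev]
      unfolding eigenvalues_def by blast
    have "\<tau> j \<noteq> \<tau> 0"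
      using assms(8) j by (force simp: inj_on_def)
    then have "b \<noteq> b0"
      using b b0 assms(10) by auto
    then show "t \<in> l ` (B - {b0})"
      using b j by force
  qed
  let ?S = "\<Sum>b\<in>B - {b0}. poly f (l b)" and ?R = "\<Sum>i\<in>{1..degree f}. ?T i"
  have le: "poly f (l b) \<le> 0" if "b \<in> B - {b0}" for b
    using rest that assms(13) by (metis (no_types, lifting) imageE image_eqI)
  have ge: "?T i \<ge> 0" if "i \<in> {1..degree f}" for i
    using that assms(2,5,6,15) by (intro mult_nonneg_nonneg trace_poly_matrix_F_nonneg) auto
  have "trace (poly_matrix f ?A) = poly f k + ?S"
    using trace_poly_matrix_eigenbasis[OF B ev] B(1) b0
    by (simp add: sum.remove[OF B(1) b0(1)])
  moreover have "trace (poly_matrix f ?A) = c 0 * real CARD('v) + ?R"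
  proof -
    have "poly_matrix f ?A = (\<Sum>i\<le>degree f. c i *\<^sub>R poly_matrix (F r u i) ?A)"
      by (subst assms(11)) (simp add: poly_matrix_sum poly_matrix_smult)
    then have "trace (poly_matrix f ?A) = (\<Sum>i\<le>degree f. ?T i)"
      by (simp add: trace_def sum.swap[of _ UNIV] sum_distrib_left)
    \<comment> \<open>The term at 0 is split off because \<open>F r u 0\<close> evaluates to the
      identity matrix, whose trace is the number of vertices.\<close>
    also have "{..degree f} = insert 0 {1..degree f}" by auto
    finally show ?thesis
      by (simp add: trace_I)
  qed
  ultimately have key: "c 0 * real CARD('v) = poly f k + ?S - ?R" by simp
  have "?S \<le> 0" "?R \<ge> 0"
    using le ge by (auto intro: sum_nonpos sum_nonneg)
  then have "c 0 * real CARD('v) \<le> poly f k"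
    and "c 0 * real CARD('v) = poly f k \<longleftrightarrow> ?S = 0 \<and> ?R = 0"
    using key by auto
  \<comment> \<open>A sum of nonpositive terms vanishes only termwise. Passing to the image set
    discards multiplicities, so that \<open>rest\<close> turns this into the condition on the
    \<open>\<tau> j\<close>.\<close>
  moreover have "?S = 0 \<longleftrightarrow> (\<forall>t\<in>l ` (B - {b0}). poly f t = 0)"
    using le B(1) sum_nonneg_eq_0_iff[of "B - {b0}" "\<lambda>b. - poly f (l b)"]
    by (simp add: sum_negf)
  moreover have "?R = 0 \<longleftrightarrow> (\<forall>i\<in>{1..degree f}. ?T i = 0)"
    using ge by (intro sum_nonneg_eq_0_iff) auto
  ultimately show ?thesis
    unfolding rest using assms(14) by (simp add: field_simps)
qed

end
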